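(* Let $G$ and $H$ be finitely generated groups with exponential growth and subexponential growth, respectively, equipped with finite symmetric generating sets $S_G$, $S_H$, and equip $G\times H$ with the generating set $(S_G\times\{e_H\})\cup(\{e_G\}\times S_H)$. Let $v_H(n)=|B^H_n|$ be the growth function of $H$. Then $G\times H$ does not have the $\{f(n)\}$-retainment property for any function $f:\{1,2,\dots\}\to\{0,1,2,\dots\}$ satisfying $$\sum_{k=1}^{10n} f(k)=o(v_H(n))\quad\text{as } n\to\infty.$$
   Context: For a finitely generated group $G$ with finite symmetric generating set $S$, consider its Cayley graph, with vertex set $G$ and edges $x\sim xs$, $s\in S$. Let $B_n=B_n^G$ be the ball of radius $n$ around the identity $e_G$ for the graph distance and $v_G(n)=|B_n|$. For functions write $a\preceq b$ if there is a constant $C>0$ with $a(n)\le C\,b(Cn)+C$ for all $n$, and $a\simeq b$ (equivalent) if $a\preceq b$ and $b\preceq a$. $G$ has exponential growth if $v_G(n)\simeq\gamma^n$ for some $\gamma>1$; it has subexponential growth if $\lim_n \frac1n\log v_G(n)=0$. Fire process on a Cayley graph $\Gamma$: a fire breaks out at time $0$ on a finite set $F_0$ of vertices. At each time $n\ge 1$ a set $W_n$ of at most $f(n)$ vertices not on fire ($W_n\cap F_{n-1}=\emptyset$) is declared protected forever, and then $F_n=F_{n-1}\cup\{x : x\sim y \text{ for some } y\in F_{n-1},\ x\notin W_1\cup\dots\cup W_n\}$. Such a sequence $\{W_n\}$ is an $\{f(n)\}$-allowed strategy. Let $U=\Gamma\setminus\bigcup_n F_n$. $\Gamma$ has the $\{f(n)\}$-retainment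 property if for every finite $F_0$ there is an $\{f(n)\}$-allowed strategy such that $n\mapsto|U\cap B_n^\Gamma|$ is equivalent to $v_\Gamma$. *)

theory Defs
  imports "HOL-Algebra.Algebra" "HOL-Library.Landau_Symbols" "HOL-Library.Extended_Nat"
begin

text \<open>
  Graphs are given by a vertex set \<open>V\<close> and an edge relation \<open>E\<close> on \<open>V\<close>.
  The infimum over the empty set is \<open>\<infinity>\<close>, so vertices in different components
  have infinite distance.
\<close>

definition graph_dist :: "('a \<times> 'a) set \<Rightarrow> 'a \<Rightarrow> 'a \<Rightarrow> enat" where
  "graph_dist E x y = (INF k \<in> {k. (x, y) \<in> E ^^ k}. enat k)"

definition finite_symmetric_generating_set :: "('a, 'b) monoid_scheme \<Rightarrow> 'a set \<Rightarrow> bool" where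
  "finite_symmetric_generating_set G S \<longleftrightarrow>
     finite S \<and> S \<subseteq> carrier G \<and> (\<forall>s\<in>S. inv\<^bsub>G\<^esub> s \<in> S) \<and> generate G S = carrier G"

definition cayley_edges :: "('a, 'b) monoid_scheme \<Rightarrow> 'a set \<Rightarrow> ('a \<times> 'a) set" where
  "cayley_edges G S = {(x, x \<otimes>\<^bsub>G\<^esub> s) | x s. x \<in> carrier G \<and> s \<in> S}"

definition cayley_ball :: "('a, 'b) monoid_scheme \<Rightarrow> 'a set \<Rightarrow> nat \<Rightarrow> 'a set" where
  "cayley_ball G S n = {x \<in> carrier G. graph_dist (cayley_edges G S) \<one>\<^bsub>G\<^esub> x \<le> enat n}"

definition growth :: "('a, 'b) monoid_scheme \<Rightarrow> 'a set \<Rightarrow> nat \<Rightarrow> nat" where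
  "growth G S n = card (cayley_ball G S n)"

text \<open>
  The constant \<open>C\<close> is real, while the functions compared live on the natural numbers, so
  \<open>b (C n)\<close> is read as \<open>b\<close> at the integer part of \<open>C n\<close> (as for balls of real radius).
\<close>

definition growth_le :: "(nat \<Rightarrow> real) \<Rightarrow> (nat \<Rightarrow> real) \<Rightarrow> bool" where
  "growth_le a b \<longleftrightarrow> (\<exists>C::real. C > 0 \<and> (\<forall>n. a n \<le> C * b (nat \<lfloor>C * real n\<rfloor>) + C))"

definition growth_equiv :: "(nat \<Rightarrow> real) \<Rightarrow> (nat \<Rightarrow> real) \<Rightarrow> bool" where
  "growth_equiv a b \<longleftrightarrow> growth_le a b \<and> growth_le b a"

definition exponential_growth :: "('a, 'b) monoid_scheme \<Rightarrow> 'a set \<Rightarrow> bool" where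
  "exponential_growth G S \<longleftrightarrow>
     (\<exists>\<gamma>::real. \<gamma> > 1 \<and> growth_equiv (\<lambda>n. real (growth G S n)) (\<lambda>n. \<gamma> ^ n))"

definition subexponential_growth :: "('a, 'b) monoid_scheme \<Rightarrow> 'a set \<Rightarrow> bool" where
  "subexponential_growth G S \<longleftrightarrow>
     (\<lambda>n. 1 / real n * ln (real (growth G S n))) \<longlonglongrightarrow> 0"

text \<open>
  Protected sets \<open>W n\<close> and bounds \<open>f n\<close> are indexed by \<open>n \<ge> 1\<close>;
  the values \<open>W 0\<close> and \<open>f 0\<close> are never used.
\<close>

primrec fire :: "('a \<times> 'a) set \<Rightarrow> 'a set \<Rightarrow> (nat \<Rightarrow> 'a set) \<Rightarrow> nat \<Rightarrow> 'a set" where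
  "fire E F0 W 0 = F0"
| "fire E F0 W (Suc n) =
     fire E F0 W n \<union>
     {x. (\<exists>y \<in> fire E F0 W n. (x, y) \<in> E) \<and> x \<notin> (\<Union>k\<in>{1..Suc n}. W k)}"

definition allowed_strategy ::
  "'a set \<Rightarrow> ('a \<times> 'a) set \<Rightarrow> (nat \<Rightarrow> nat) \<Rightarrow> 'a set \<Rightarrow> (nat \<Rightarrow> 'a set) \<Rightarrow> bool" where
  "allowed_strategy V E f F0 W \<longleftrightarrow>
     (\<forall>n\<ge>1. W n \<subseteq> V \<and> finite (W n) \<and> card (W n) \<le> f n \<and> W n \<inter> fire E F0 W (n - 1) = {})"

definition unburned :: "'a set \<Rightarrow> ('a \<times> 'a) set \<Rightarrow> 'a set \<Rightarrow> (nat \<Rightarrow> 'a set) \<Rightarrow> 'a set" where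
  "unburned V E F0 W = V - (\<Union>n. fire E F0 W n)"

definition retainment_property ::
  "('a, 'b) monoid_scheme \<Rightarrow> 'a set \<Rightarrow> (nat \<Rightarrow> nat) \<Rightarrow> bool" where
  "retainment_property G S f \<longleftrightarrow>
     (\<forall>F0. finite F0 \<and> F0 \<subseteq> carrier G \<longrightarrow>
        (\<exists>W. allowed_strategy (carrier G) (cayley_edges G S) f F0 W \<and>
             growth_equiv
               (\<lambda>n. real (card (unburned (carrier G) (cayley_edges G S) F0 W \<inter> cayley_ball G S n)))
               (\<lambda>n. real (growth G S n))))"

end

theory Submission imports Defs begin

text \<open>
  Write \<open>v\<^sub>G\<close>, \<open>v\<^sub>H\<close> for the growth functions and think of \<open>G \<times> H\<close> as made of fibres
  \<open>{g} \<times> H\<close> and rows \<open>G \<times> {h}\<close>. For large \<open>n\<close>, fewer than \<open>v\<^sub>H(n)\<close> vertices are protected by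
  time \<open>10n\<close>. Distinct vertices of \<open>{g} \<times> B\<^sub>n\<^sup>H\<close> lie in distinct rows, so one of the rows meeting
  the ball \<open>B\<^sub>n\<^sup>H\<close> is still free of protection: if the set \<open>{g} \<times> B\<^sub>n\<^sup>H\<close> burns, the fire travels
  along that row to every fibre \<open>{g'} \<times> H\<close> over \<open>B\<^sub>n\<^sup>G\<close>, and if that fibre is unprotected too, it then
  fills a ball of it (\<open>burning_fibre_spreads\<close>).

  Since \<open>G\<close> grows faster than \<open>H\<close>, there are more fibres over \<open>B\<^sub>n\<^sup>G\<close> than protected vertices, so
  unprotected fibres exist. Starting from the finite fire \<open>{e} \<times> B\<^sub>R\<^sup>H\<close>, the fire can therefore
  jump from a fibre burning at scale \<open>n\<close> to a fresh fibre burning at scale \<open>2n\<close>, in time linear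
  in \<open>n\<close>; at every scale \<open>n = 2\<^sup>i R\<close> some \<open>{g} \<times> B\<^sub>n\<^sup>H\<close> over \<open>B\<^sub>n\<^sup>G\<close> burns by time \<open>6n\<close>
  (\<open>burning_fibre_at_dyadic_scales\<close>).

  From there every unprotected fibre over \<open>B\<^sub>n\<^sup>G\<close> burns inside \<open>B\<^sub>n\<close> by time \<open>10n\<close>. Only fewer
  than \<open>v\<^sub>H(n)\<close> fibres are left, so at most \<open>v\<^sub>H(n)\<^sup>2\<close> vertices of \<open>B\<^sub>n\<close> survive
  (\<open>card_unburned_le\<close>). That is subexponential, whereas \<open>G \<times> H\<close> grows at least as fast as \<open>G\<close>,
  and no rescaling of \<open>n\<close> by a constant can make up for the difference
  (\<open>exponential_beats_square_of_subexponential\<close>).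
\<close>

section \<open>Balls in Cayley graphs\<close>

lemma in_cayley_ball_iff:
  "x \<in> cayley_ball G S n \<longleftrightarrow>
     x \<in> carrier G \<and> (\<exists>k\<le>n. (\<one>\<^bsub>G\<^esub>, x) \<in> cayley_edges G S ^^ k)"
proof -
  let ?K = "{k. (\<one>\<^bsub>G\<^esub>, x) \<in> cayley_edges G S ^^ k}"
  have "(INF k\<in>?K. enat k) \<le> enat n \<longleftrightarrow> (\<exists>k\<le>n. k \<in> ?K)"
  proof
    assume le: "(INF k\<in>?K. enat k) \<le> enat n"
    show "\<exists>k\<le>n. k \<in> ?K"
    proof (rule ccontr)
      assume "\<not> (\<exists>k\<le>n. k \<in> ?K)"
      then have "enat (Suc n) \<le> (INF k\<in>?K. enat k)"
        by (intro INF_greatest) (force simp: not_le Suc_le_eq)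
      with le have "enat (Suc n) \<le> enat n" by (rule order_trans[rotated])
      then show False by simp
    qed
  next
    assume "\<exists>k\<le>n. k \<in> ?K"
    then show "(INF k\<in>?K. enat k) \<le> enat n"
      by (meson INF_lower2 enat_ord_simps(1))
  qed
  then show ?thesis by (auto simp: cayley_ball_def graph_dist_def)
qed

lemma cayley_ball_mono: "m \<le> n \<Longrightarrow> cayley_ball G S m \<subseteq> cayley_ball G S n"
  unfolding subset_iff in_cayley_ball_iff using le_trans by blast

lemma finite_cayley_ball:
  assumes "finite S"
  shows "finite (cayley_ball G S n)"
proof -
  let ?E = "cayley_edges G S"
  have step: "finite (?E `` A)" if "finite A" for A
  proof (rule finite_subset)
    show "?E `` A \<subseteq> (\<lambda>(x, s). x \<otimes>\<^bsub>G\<^esub> s) ` (A \<times> S)"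
      by (auto simp: cayley_edges_def)
    show "finite ((\<lambda>(x, s). x \<otimes>\<^bsub>G\<^esub> s) ` (A \<times> S))"
      using assms that by simp
  qed
  have "finite ((?E ^^ k) `` {\<one>\<^bsub>G\<^esub>})" for k
    by (induction k) (simp_all add: relcomp_Image step)
  then have "finite (\<Union>k\<le>n. (?E ^^ k) `` {\<one>\<^bsub>G\<^esub>})" by simp
  then show ?thesis
    by (rule finite_subset[rotated]) (auto simp: in_cayley_ball_iff)
qed

lemma one_in_cayley_ball: "group G \<Longrightarrow> \<one>\<^bsub>G\<^esub> \<in> cayley_ball G S n"
  by (auto simp: in_cayley_ball_iff group.is_monoid intro!: exI[of _ 0])

lemma growth_pos:
  assumes "group G" "finite S"
  shows "growth G S n > 0"
  using one_in_cayley_ball[OF assms(1), of S n] finite_cayley_ball[OF assms(2), of G n]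
  by (auto simp: growth_def card_gt_0_iff)

lemma growth_mono: "finite S \<Longrightarrow> m \<le> n \<Longrightarrow> growth G S m \<le> growth G S n"
  unfolding growth_def by (intro card_mono finite_cayley_ball cayley_ball_mono)

lemma sym_cayley_edges:
  assumes "group G" "finite_symmetric_generating_set G S"
  shows "sym (cayley_edges G S)"
proof (rule symI)
  interpret group G by fact
  fix x y assume "(x, y) \<in> cayley_edges G S"
  then obtain s where s: "x \<in> carrier G" "s \<in> S" "y = x \<otimes>\<^bsub>G\<^esub> s"
    by (auto simp: cayley_edges_def)
  then have "s \<in> carrier G" "inv\<^bsub>G\<^esub> s \<in> S"
    using assms(2) by (auto simp: finite_symmetric_generating_set_def)
  moreover from this s have "y \<in> carrier G" "x = y \<otimes>\<^bsub>G\<^esub> inv\<^bsub>G\<^esub> s"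
    by (simp_all add: m_assoc)
  ultimately show "(y, x) \<in> cayley_edges G S"
    unfolding cayley_edges_def by blast
qed

lemma cayley_ball_connect:
  assumes "group G" "finite_symmetric_generating_set G S"
    and "x \<in> cayley_ball G S m" "y \<in> cayley_ball G S n"
  obtains k where "k \<le> m + n" "(x, y) \<in> cayley_edges G S ^^ k"
proof -
  let ?E = "cayley_edges G S"
  obtain i j where "i \<le> m" "(\<one>\<^bsub>G\<^esub>, x) \<in> ?E ^^ i" and j: "j \<le> n" "(\<one>\<^bsub>G\<^esub>, y) \<in> ?E ^^ j"
    using assms(3,4) by (auto simp: in_cayley_ball_iff)
  moreover have "sym (?E ^^ i)"
  proof (induction i)
    case (Suc i)
    then have "(?E ^^ i)\<inverse> = ?E ^^ i" "?E\<inverse> = ?E"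
      using sym_cayley_edges[OF assms(1,2)] by (simp_all add: sym_conv_converse_eq)
    then show ?case
      by (simp add: sym_conv_converse_eq converse_relcomp relpow_commute)
  qed (simp add: sym_Id)
  ultimately have "(x, y) \<in> ?E ^^ (i + j)"
    unfolding relpow_add by (blast dest: symD)
  with \<open>i \<le> m\<close> \<open>j \<le> n\<close> show ?thesis by (intro that[of "i + j"]) simp_all
qed

section \<open>Products\<close>

abbreviation product_generators ::
  "('a, 'c) monoid_scheme \<Rightarrow> 'a set \<Rightarrow> ('b, 'd) monoid_scheme \<Rightarrow> 'b set \<Rightarrow> ('a \<times> 'b) set" where
  "product_generators G S H T \<equiv> (S \<times> {\<one>\<^bsub>H\<^esub>}) \<union> ({\<one>\<^bsub>G\<^esub>} \<times> T)"

lemma cayley_edges_product: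
  assumes "group G" "group H"
  shows "((x, y), (x', y')) \<in> cayley_edges (G \<times>\<times> H) (product_generators G S H T) \<longleftrightarrow>
    (x, x') \<in> cayley_edges G S \<and> y \<in> carrier H \<and> y' = y \<or>
    (y, y') \<in> cayley_edges H T \<and> x \<in> carrier G \<and> x' = x"
proof -
  interpret G: group G by fact
  interpret H: group H by fact
  show ?thesis
    by (auto simp: cayley_edges_def) (metis G.r_one H.r_one)+
qed

lemma cayley_ball_product_subset:
  assumes "group G" "group H"
  shows "cayley_ball (G \<times>\<times> H) (product_generators G S H T) n
    \<subseteq> cayley_ball G S n \<times> cayley_ball H T n"
proof -
  let ?E = "cayley_edges (G \<times>\<times> H) (product_generators G S H T)"
  have "(\<exists>i\<le>k. (a, c) \<in> cayley_edges G S ^^ i) \<and> (\<exists>j\<le>k. (b, d) \<in> cayley_edges H T ^^ j)"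
    if "((a, b), (c, d)) \<in> ?E ^^ k" for a b c d k
    using that
  proof (induction k arbitrary: c d)
    case (Suc k)
    from Suc.prems obtain c' d' where "((a, b), (c', d')) \<in> ?E ^^ k"
      and st: "((c', d'), (c, d)) \<in> ?E" by auto
    from Suc.IH[OF this(1)] obtain i j where
      i: "i \<le> k" "(a, c') \<in> cayley_edges G S ^^ i" and
      j: "j \<le> k" "(b, d') \<in> cayley_edges H T ^^ j" by blast
    then have "Suc i \<le> Suc k" "Suc j \<le> Suc k" "i \<le> Suc k" "j \<le> Suc k" by simp_all
    with i j st show ?case
      unfolding cayley_edges_product[OF assms] by (metis relpow_Suc_I)
  qed auto
  then have "(\<exists>i\<le>n. (a, c) \<in> cayley_edges G S ^^ i) \<and> (\<exists>j\<le>n. (b, d) \<in> cayley_edges H T ^^ j)"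
    if "k \<le> n" "((a, b), (c, d)) \<in> ?E ^^ k" for a b c d k
    using that le_trans by blast
  then show ?thesis
    by (auto simp: in_cayley_ball_iff)
qed

lemma growth_le_growth_product:
  assumes "group G" "group H" "finite S" "finite T"
  shows "growth G S n \<le> growth (G \<times>\<times> H) (product_generators G S H T) n"
proof -
  let ?E = "cayley_edges (G \<times>\<times> H) (product_generators G S H T)"
  let ?\<iota> = "\<lambda>g. (g, \<one>\<^bsub>H\<^esub>)"
  interpret H: group H by fact
  have "(?\<iota> a, ?\<iota> b) \<in> ?E ^^ k" if "(a, b) \<in> cayley_edges G S ^^ k" for a b k
    using that
  proof (induction k arbitrary: b)
    case (Suc k)
    then obtain c where "(?\<iota> a, ?\<iota> c) \<in> ?E ^^ k" "(?\<iota> c, ?\<iota> b) \<in> ?E"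
      unfolding cayley_edges_product[OF assms(1,2)] by auto
    then show ?case by auto
  qed auto
  then have "?\<iota> ` cayley_ball G S n
      \<subseteq> cayley_ball (G \<times>\<times> H) (product_generators G S H T) n"
    by (force simp: in_cayley_ball_iff)
  then have "card (?\<iota> ` cayley_ball G S n)
      \<le> card (cayley_ball (G \<times>\<times> H) (product_generators G S H T) n)"
    using assms(3,4) by (intro card_mono finite_cayley_ball) auto
  then show ?thesis
    by (simp add: growth_def card_image inj_on_def)
qed

section \<open>Spread of the fire\<close>

lemma fire_mono: "s \<le> t \<Longrightarrow> fire E F0 W s \<subseteq> fire E F0 W t"
  by (rule lift_Suc_mono_le) auto

text \<open>
  To be applied with \<open>\<phi>\<close> the inclusion of a row or of a fibre into the product, when its image
  avoids all protected vertices. Edges are reversed because the fire enters \<open>x\<close> through an edge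
  from \<open>x\<close> to a burning \<open>y\<close>.
\<close>

lemma fire_spreads_along_embedded_walk:
  assumes edge: "\<And>u v. (u, v) \<in> E' \<Longrightarrow> (\<phi> v, \<phi> u) \<in> E"
    and free: "\<And>u j. j \<in> {1..T} \<Longrightarrow> \<phi> u \<notin> W j"
    and "(u, v) \<in> E' ^^ k" "\<phi> u \<in> fire E F0 W t" "t + k \<le> T"
  shows "\<phi> v \<in> fire E F0 W T"
proof -
  have "\<phi> v \<in> fire E F0 W (t + k)"
    using assms(3,5)
  proof (induction k arbitrary: v)
    case 0
    then show ?case using assms(4) by simp
  next
    case (Suc k)
    then obtain w where "\<phi> w \<in> fire E F0 W (t + k)" "(w, v) \<in> E'" by auto
    moreover have "\<phi> v \<notin> (\<Union>j\<in>{1..Suc (t + k)}. W j)"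
      using free Suc.prems by auto
    ultimately show ?case using edge by auto
  qed
  then show ?thesis using fire_mono[OF assms(5), of E F0 W] by blast
qed

locale fire_on_product =
  fixes G :: "('a, 'c) monoid_scheme" and H :: "('b, 'd) monoid_scheme"
    and S :: "'a set" and T :: "'b set" and f :: "nat \<Rightarrow> nat"
    and F0 :: "('a \<times> 'b) set" and W :: "nat \<Rightarrow> ('a \<times> 'b) set"
  assumes group_G: "group G" and group_H: "group H"
    and gen_G: "finite_symmetric_generating_set G S"
    and gen_H: "finite_symmetric_generating_set H T"
    and allowed: "allowed_strategy (carrier (G \<times>\<times> H))
      (cayley_edges (G \<times>\<times> H) (product_generators G S H T)) f F0 W"
begin

abbreviation edges :: "(('a \<times> 'b) \<times> ('a \<times> 'b)) set" where
  "edges \<equiv> cayley_edges (G \<times>\<times> H) (product_generators G S H T)"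

abbreviation burning :: "nat \<Rightarrow> ('a \<times> 'b) set" where
  "burning \<equiv> fire edges F0 W"

abbreviation protected_by :: "nat \<Rightarrow> ('a \<times> 'b) set" where
  "protected_by t \<equiv> (\<Union>k\<in>{1..t}. W k)"

lemma finite_generators: "finite S" "finite T"
  using gen_G gen_H by (auto simp: finite_symmetric_generating_set_def)

lemma finite_protected: "finite (protected_by t)"
  using allowed by (auto simp: allowed_strategy_def)

lemma card_protected_le: "card (protected_by t) \<le> (\<Sum>k=1..t. f k)"
proof -
  have "card (protected_by t) \<le> (\<Sum>k=1..t. card (W k))"
    by (rule card_UN_le) simp
  also have "\<dots> \<le> (\<Sum>k=1..t. f k)"
    using allowed by (intro sum_mono) (auto simp: allowed_strategy_def)
  finally show ?thesis .
qed

lemma burns_along_G: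
  assumes "h \<in> carrier H" "h \<notin> snd ` protected_by t'"
    and "(g, h) \<in> burning t" "g \<in> cayley_ball G S m" "g' \<in> cayley_ball G S n"
    and "t + m + n \<le> t'"
  shows "(g', h) \<in> burning t'"
proof -
  obtain k where k: "k \<le> m + n" "(g, g') \<in> cayley_edges G S ^^ k"
    using cayley_ball_connect[OF group_G gen_G] assms(4,5) by blast
  show ?thesis
  proof (rule fire_spreads_along_embedded_walk[where \<phi> = "\<lambda>g. (g, h)" and k = k and t = t and u = g])
    show "((v, h), (u, h)) \<in> edges" if "(u, v) \<in> cayley_edges G S" for u v
      unfolding cayley_edges_product[OF group_G group_H]
      using that assms(1) sym_cayley_edges[OF group_G gen_G] by (auto dest: symD)
    show "(u, h) \<notin> W j" if "j \<in> {1..t'}" for u j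
      using that assms(2) by force
  qed (use k assms in \<open>simp_all\<close>)
qed

lemma burns_along_H:
  assumes "g \<in> carrier G" "g \<notin> fst ` protected_by t'"
    and "(g, h) \<in> burning t" "h \<in> cayley_ball H T m" "h' \<in> cayley_ball H T n"
    and "t + m + n \<le> t'"
  shows "(g, h') \<in> burning t'"
proof -
  obtain k where k: "k \<le> m + n" "(h, h') \<in> cayley_edges H T ^^ k"
    using cayley_ball_connect[OF group_H gen_H] assms(4,5) by blast
  show ?thesis
  proof (rule fire_spreads_along_embedded_walk[where \<phi> = "\<lambda>h. (g, h)" and k = k and t = t and u = h])
    show "((g, v), (g, u)) \<in> edges" if "(u, v) \<in> cayley_edges H T" for u v
      unfolding cayley_edges_product[OF group_G group_H]
      using that assms(1) sym_cayley_edges[OF group_H gen_H] by (auto dest: symD)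
    show "(g, u) \<notin> W j" if "j \<in> {1..t'}" for u j
      using that assms(2) by force
  qed (use k assms in \<open>simp_all\<close>)
qed

text \<open>
  Pigeonhole: each protected vertex spoils one row and one fibre only.
\<close>

lemma ball_H_has_unprotected_row:
  assumes "(\<Sum>k=1..t. f k) < growth H T n"
  obtains h where "h \<in> cayley_ball H T n" "h \<notin> snd ` protected_by t"
proof -
  have "card (snd ` protected_by t) < card (cayley_ball H T n)"
    using card_image_le[OF finite_protected] card_protected_le assms
    unfolding growth_def by (meson le_less_trans)
  then have "\<not> cayley_ball H T n \<subseteq> snd ` protected_by t"
    using finite_protected by (meson card_mono finite_imageI not_le)
  with that show ?thesis by blast
qed

lemma ball_G_has_unprotected_fibre:
  assumes "(\<Sum>k=1..t. f k) < growth G S n"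
  obtains g where "g \<in> cayley_ball G S n" "g \<notin> fst ` protected_by t"
proof -
  have "card (fst ` protected_by t) < card (cayley_ball G S n)"
    using card_image_le[OF finite_protected] card_protected_le assms
    unfolding growth_def by (meson le_less_trans)
  then have "\<not> cayley_ball G S n \<subseteq> fst ` protected_by t"
    using finite_protected by (meson card_mono finite_imageI not_le)
  with that show ?thesis by blast
qed

text \<open>
  A row \<open>h \<in> B\<^sub>n\<^sup>H\<close> unprotected until \<open>10n\<close> carries the fire from \<open>g\<close> to \<open>g'\<close> through the identity
  of \<open>G\<close>, a walk of length at most \<open>2n\<close>, so \<open>(g', h)\<close> burns at time \<open>8n\<close>. Inside the fibre over
  \<open>g'\<close>, every vertex of the ball of radius \<open>m\<close> is within \<open>n + m\<close> of \<open>h\<close>. The radius \<open>m\<close> is free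
  because \<open>m = 2n\<close> serves to pass to the next scale and \<open>m = n\<close> to count survivors.
\<close>

lemma burning_fibre_spreads:
  assumes "(\<Sum>k=1..10 * n. f k) < growth H T n"
    and g: "g \<in> cayley_ball G S n" "{g} \<times> cayley_ball H T n \<subseteq> burning (6 * n)"
    and g': "g' \<in> cayley_ball G S n" "g' \<notin> fst ` protected_by t"
    and t: "9 * n + m \<le> t"
  shows "{g'} \<times> cayley_ball H T m \<subseteq> burning t"
proof clarify
  fix h' assume h': "h' \<in> cayley_ball H T m"
  obtain h where h: "h \<in> cayley_ball H T n" "h \<notin> snd ` protected_by (10 * n)"
    using ball_H_has_unprotected_row[OF assms(1)] by blast
  have "h \<notin> snd ` protected_by (8 * n)"
    using h(2) by fastforce
  then have "(g', h) \<in> burning (8 * n)"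
    using g h(1) g'(1) by (intro burns_along_G[of h _ g "6 * n" n g' n]) (auto simp: cayley_ball_def)
  then show "(g', h') \<in> burning t"
    using g' h(1) h' t by (intro burns_along_H[of g' _ h "8 * n" n h' m]) (auto simp: cayley_ball_def)
qed

text \<open>
  The rate \<open>6n\<close> reproduces itself under doubling: filling the ball of radius \<open>2n\<close> in a new fibre
  takes until \<open>9n + 2n \<le> 6 \<cdot> 2n\<close>. The new fibre must stay unprotected until \<open>12n\<close>; the bound on
  protected vertices at scale \<open>2n\<close> covers this, but it is in terms of \<open>v\<^sub>H(2n)\<close>, and
  the hypothesis \<open>v\<^sub>H(2n) \<le> v\<^sub>G(n)\<close> turns it into a pigeonhole argument over \<open>B\<^sub>n\<^sup>G\<close>.
\<close>

lemma burning_fibre_at_dyadic_scales: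
  assumes F0: "{\<one>\<^bsub>G\<^esub>} \<times> cayley_ball H T R \<subseteq> F0"
    and few: "\<And>n. n \<ge> R \<Longrightarrow> (\<Sum>k=1..10 * n. f k) < growth H T n"
    and big: "\<And>n. n \<ge> R \<Longrightarrow> growth H T (2 * n) \<le> growth G S n"
  shows "\<exists>g \<in> cayley_ball G S (2 ^ i * R).
    {g} \<times> cayley_ball H T (2 ^ i * R) \<subseteq> burning (6 * (2 ^ i * R))"
proof (induction i)
  case 0
  have "{\<one>\<^bsub>G\<^esub>} \<times> cayley_ball H T R \<subseteq> burning (6 * R)"
    using F0 fire_mono[of 0 "6 * R" edges F0 W] by auto
  then show ?case using one_in_cayley_ball[OF group_G] by (intro bexI[of _ "\<one>\<^bsub>G\<^esub>"]) simp_all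
next
  case (Suc i)
  define n where "n = 2 ^ i * R"
  have n: "n \<ge> R" by (simp add: n_def)
  from Suc.IH obtain g where g: "g \<in> cayley_ball G S n" "{g} \<times> cayley_ball H T n \<subseteq> burning (6 * n)"
    by (auto simp: n_def)
  have "(\<Sum>k=1..12 * n. f k) \<le> (\<Sum>k=1..10 * (2 * n). f k)"
    by (intro sum_mono2) auto
  also have "\<dots> < growth H T (2 * n)"
    using few[of "2 * n"] n by simp
  also have "\<dots> \<le> growth G S n" using big n by simp
  finally obtain g' where g': "g' \<in> cayley_ball G S n" "g' \<notin> fst ` protected_by (12 * n)"
    using ball_G_has_unprotected_fibre by blast
  have "{g'} \<times> cayley_ball H T (2 * n) \<subseteq> burning (12 * n)"
    using burning_fibre_spreads[OF few[OF n] g g', of "2 * n"] by simp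
  moreover have "g' \<in> cayley_ball G S (2 * n)"
    using g'(1) cayley_ball_mono[of n "2 * n"] by fastforce
  ultimately show ?case
    by (intro bexI[of _ g']) (simp_all add: n_def mult.assoc)
qed

text \<open>
  A survivor in \<open>B\<^sub>n\<close> lies in a fibre that got protected by time \<open>10n\<close>. There are at most
  \<open>v\<^sub>H(n)\<close> such fibres, each with at most \<open>v\<^sub>H(n)\<close> vertices in the ball.
\<close>

lemma card_unburned_le:
  assumes few: "(\<Sum>k=1..10 * n. f k) < growth H T n"
    and g: "g \<in> cayley_ball G S n" "{g} \<times> cayley_ball H T n \<subseteq> burning (6 * n)"
  shows "card (unburned (carrier (G \<times>\<times> H)) edges F0 W
      \<inter> cayley_ball (G \<times>\<times> H) (product_generators G S H T) n) \<le> (growth H T n)\<^sup>2"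
    (is "card ?U \<le> _")
proof -
  let ?P = "fst ` protected_by (10 * n)"
  have "?U \<subseteq> ?P \<times> cayley_ball H T n"
  proof
    fix z assume z: "z \<in> ?U"
    obtain g' h where [simp]: "z = (g', h)" by (cases z)
    from z have gh: "g' \<in> cayley_ball G S n" "h \<in> cayley_ball H T n"
      using cayley_ball_product_subset[OF group_G group_H] by fastforce+
    have "g' \<in> ?P"
    proof (rule ccontr)
      assume "g' \<notin> ?P"
      then have "(g', h) \<in> burning (10 * n)"
        using burning_fibre_spreads[OF few g gh(1), of "10 * n" n] gh(2) by auto
      with z show False by (auto simp: unburned_def)
    qed
    with gh(2) show "z \<in> ?P \<times> cayley_ball H T n" by simp
  qed
  then have "card ?U \<le> card (?P \<times> cayley_ball H T n)"
    using finite_protected finite_cayley_ball[OF finite_generators(2)]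
    by (intro card_mono finite_cartesian_product finite_imageI) simp_all
  also have "\<dots> = card ?P * growth H T n"
    by (simp add: card_cartesian_product growth_def)
  also have "\<dots> \<le> growth H T n * growth H T n"
    using card_image_le[OF finite_protected, of fst "10 * n"] card_protected_le[of "10 * n"] few
    by (intro mult_right_mono) linarith+
  finally show ?thesis by (simp add: power2_eq_square)
qed

end

section \<open>Comparing growth rates\<close>

text \<open>
  Equivalence with \<open>\<gamma>\<^sup>n\<close> bounds \<open>\<gamma>\<^sup>j\<close> by the growth at \<open>C j\<close>; taking \<open>j\<close> near \<open>n / C\<close> gives a bound
  at \<open>n\<close> with rate \<open>ln \<gamma> / C\<close> up to a constant factor, which halving the rate absorbs.
\<close>

lemma exponential_growth_lower_bound:
  assumes "exponential_growth G S" "finite S" "group G"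
  obtains c where "c > 0" "\<forall>\<^sub>F n in sequentially. exp (c * real n) \<le> real (growth G S n)"
proof -
  from assms(1) obtain \<gamma> C :: real where \<gamma>: "\<gamma> > 1" and C: "C > 0"
    and le: "\<And>n. \<gamma> ^ n \<le> C * real (growth G S (nat \<lfloor>C * real n\<rfloor>)) + C"
    unfolding exponential_growth_def growth_equiv_def growth_le_def by blast
  define a where "a = ln \<gamma> / C"
  have a: "a > 0" using \<gamma> C by (simp add: a_def)
  have bound: "exp (a * real n) / \<gamma> \<le> 2 * C * real (growth G S n)" for n
  proof -
    define j where "j = nat \<lfloor>real n / C\<rfloor>"
    have j: "real n / C < real j + 1" "real j \<le> real n / C"
      using C by (auto simp: j_def)
    have "C * real j \<le> real n"
      using j(2) C by (simp add: field_simps)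
    then have "nat \<lfloor>C * real j\<rfloor> \<le> n" by linarith
    then have gr: "growth G S (nat \<lfloor>C * real j\<rfloor>) \<le> growth G S n"
      by (rule growth_mono[OF assms(2)])
    have "exp (a * real n) = exp (ln \<gamma> * (real n / C))" by (simp add: a_def)
    also have "\<dots> \<le> exp (ln \<gamma> * real (Suc j))"
      using j(1) \<gamma> by (simp only: exp_le_cancel_iff) (intro mult_left_mono, simp_all)
    also have "\<dots> = \<gamma> ^ Suc j"
      using \<gamma> by (metis exp_ln exp_of_nat2_mult less_trans zero_less_one)
    finally have "exp (a * real n) / \<gamma> \<le> \<gamma> ^ j"
      using \<gamma> by (simp add: field_simps)
    also have "\<dots> \<le> C * real (growth G S (nat \<lfloor>C * real j\<rfloor>)) + C" by (rule le)
    also have "\<dots> \<le> C * real (growth G S n) + C * real (growth G S n)"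
      using gr C growth_pos[OF assms(3,2), of n] by (intro add_mono) auto
    finally show ?thesis by simp
  qed
  have "filterlim (\<lambda>n. exp (a / 2 * real n)) at_top sequentially"
    using a by (intro filterlim_compose[OF exp_at_top]
      filterlim_tendsto_pos_mult_at_top[OF tendsto_const _ filterlim_real_sequentially]) auto
  then have "\<forall>\<^sub>F n in sequentially. 2 * C * \<gamma> \<le> exp (a / 2 * real n)"
    by (simp add: filterlim_at_top)
  then have "\<forall>\<^sub>F n in sequentially. exp (a / 2 * real n) \<le> real (growth G S n)"
  proof eventually_elim
    case (elim n)
    have "2 * C * \<gamma> * exp (a / 2 * real n) \<le> exp (a / 2 * real n) * exp (a / 2 * real n)"
      using elim by (intro mult_right_mono) auto
    also have "\<dots> = exp (a * real n)" by (simp flip: exp_add)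
    also have "\<dots> \<le> 2 * C * \<gamma> * real (growth G S n)"
      using bound[of n] \<gamma> by (simp add: field_simps)
    finally show ?case using C \<gamma> by (simp add: mult_le_cancel_left)
  qed
  with a show ?thesis by (intro that[of "a / 2"]) auto
qed

lemma subexponential_growth_upper_bound:
  assumes "subexponential_growth H T" "finite T" "group H" "\<epsilon> > 0"
  shows "\<forall>\<^sub>F n in sequentially. real (growth H T n) \<le> exp (\<epsilon> * real n)"
proof -
  have "\<forall>\<^sub>F n in sequentially. 1 / real n * ln (real (growth H T n)) < \<epsilon>"
    using assms(1,4) unfolding subexponential_growth_def by (rule order_tendstoD(2))
  then show ?thesis
    using eventually_gt_at_top[of 0]
  proof eventually_elim
    case (elim n)
    then have "ln (real (growth H T n)) \<le> \<epsilon> * real n" by (simp add: field_simps)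
    then show ?case
      using growth_pos[OF assms(3,2), of n] by (metis exp_le_cancel_iff exp_ln of_nat_0_less_iff)
  qed
qed

text \<open>
  The same \<open>C\<close> rescales both argument and value, as in the relation \<open>growth_le\<close> that this is meant
  to refute.
\<close>

lemma exponential_beats_square_of_subexponential:
  assumes "exponential_growth G S" "finite S" "group G"
    and "subexponential_growth H T" "finite T" "group H" and "C > 0"
  shows "\<forall>\<^sub>F n in sequentially.
    C * (real (growth H T n))\<^sup>2 + C < real (growth G S (nat \<lfloor>real n / C\<rfloor>))"
proof -
  obtain c where c: "c > 0"
    and G: "\<forall>\<^sub>F n in sequentially. exp (c * real n) \<le> real (growth G S n)"
    using exponential_growth_lower_bound[OF assms(1-3)] .
  \<comment> \<open>The square grows at rate at most \<open>2 * \<epsilon>\<close>, half of the rate \<open>c / C\<close> on the right.\<close>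
  define \<epsilon> where "\<epsilon> = c / (4 * C)"
  have \<epsilon>: "\<epsilon> > 0" using c assms(7) by (simp add: \<epsilon>_def)
  have "filterlim (\<lambda>n. real n / C) at_top sequentially"
    using filterlim_tendsto_pos_mult_at_top[OF tendsto_const[of "1 / C"] _ filterlim_real_sequentially]
      assms(7) by simp
  then have "filterlim (\<lambda>n. nat \<lfloor>real n / C\<rfloor>) at_top sequentially"
    by (intro filterlim_compose[OF filterlim_nat_sequentially]
      filterlim_compose[OF filterlim_floor_sequentially])
  then have "\<forall>\<^sub>F n in sequentially. exp (c * real (nat \<lfloor>real n / C\<rfloor>))
      \<le> real (growth G S (nat \<lfloor>real n / C\<rfloor>))"
    using G by (rule filterlim_iff[THEN iffD1, rule_format])
  moreover have "\<forall>\<^sub>F n in sequentially. real (growth H T n) \<le> exp (\<epsilon> * real n)"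
    using subexponential_growth_upper_bound[OF assms(4-6) \<epsilon>] .
  moreover have "filterlim (\<lambda>n. exp (2 * \<epsilon> * real n)) at_top sequentially"
    using \<epsilon> by (intro filterlim_compose[OF exp_at_top]
      filterlim_tendsto_pos_mult_at_top[OF tendsto_const _ filterlim_real_sequentially]) auto
  then have "\<forall>\<^sub>F n in sequentially. 2 * C * exp c < exp (2 * \<epsilon> * real n)"
    by (simp add: filterlim_at_top_dense)
  ultimately show ?thesis
  proof eventually_elim
    case (elim n)
    have "(real (growth H T n))\<^sup>2 \<le> (exp (\<epsilon> * real n))\<^sup>2"
      using elim(2) by (intro power_mono) auto
    also have "\<dots> = exp (2 * \<epsilon> * real n)" by (simp add: power2_eq_square flip: exp_add)
    finally have sq: "(real (growth H T n))\<^sup>2 \<le> exp (2 * \<epsilon> * real n)" .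
    have "1 \<le> exp (2 * \<epsilon> * real n)" using \<epsilon> by simp
    then have "C * (real (growth H T n))\<^sup>2 + C \<le> C * exp (2 * \<epsilon> * real n) + C * exp (2 * \<epsilon> * real n)"
      using sq assms(7) by (intro add_mono) auto
    also have "\<dots> = 2 * C * exp c * exp (2 * \<epsilon> * real n) / exp c" by simp
    also have "\<dots> < exp (2 * \<epsilon> * real n) * exp (2 * \<epsilon> * real n) / exp c"
      using elim(3) by (intro divide_strict_right_mono mult_strict_right_mono) auto
    also have "\<dots> = exp (c * (real n / C - 1))"
      using assms(7) by (simp add: \<epsilon>_def field_simps flip: exp_add exp_diff)
    also have "\<dots> \<le> exp (c * real (nat \<lfloor>real n / C\<rfloor>))"
      using c by (simp, linarith)
    finally show ?case using elim(1) by linarith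
  qed
qed

lemma growth_double_le_growth:
  assumes "exponential_growth G S" "finite S" "group G"
    and "subexponential_growth H T" "finite T" "group H"
  shows "\<forall>\<^sub>F n in sequentially. growth H T (2 * n) \<le> growth G S n"
proof -
  have "\<forall>\<^sub>F n in sequentially.
      2 * (real (growth H T n))\<^sup>2 + 2 < real (growth G S (nat \<lfloor>real n / 2\<rfloor>))"
    using exponential_beats_square_of_subexponential[OF assms, of 2] by simp
  then have "\<forall>\<^sub>F n in sequentially.
      2 * (real (growth H T (2 * n)))\<^sup>2 + 2 < real (growth G S (nat \<lfloor>real (2 * n) / 2\<rfloor>))"
    by (rule eventually_compose_filterlim) (simp add: filterlim_subseq strict_mono_def)
  then show ?thesis
  proof eventually_elim
    case (elim n)
    have "real (growth H T (2 * n)) \<le> (real (growth H T (2 * n)))\<^sup>2"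
      using growth_pos[OF assms(6,5), of "2 * n"] by (intro self_le_power) auto
    also have "\<dots> \<le> 2 * (real (growth H T (2 * n)))\<^sup>2 + 2"
      using zero_le_power2[of "real (growth H T (2 * n))"] by linarith
    also have "\<dots> < real (growth G S n)" using elim by simp
    finally show ?case by simp
  qed
qed

section \<open>Failure of retainment\<close>

theorem theorem1p4:
  fixes G :: "('a, 'c) monoid_scheme" and H :: "('b, 'd) monoid_scheme"
    and S\<^sub>G :: "'a set" and S\<^sub>H :: "'b set" and f :: "nat \<Rightarrow> nat"
  assumes "group G" and "group H"
    and "finite_symmetric_generating_set G S\<^sub>G"
    and "finite_symmetric_generating_set H S\<^sub>H"
    and "exponential_growth G S\<^sub>G"
    and "subexponential_growth H S\<^sub>H"
    and "(\<lambda>n. real (\<Sum>k=1..10*n. f k)) \<in> o(\<lambda>n. real (growth H S\<^sub>H n))"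
  shows "\<not> retainment_property (G \<times>\<times> H) ((S\<^sub>G \<times> {\<one>\<^bsub>H\<^esub>}) \<union> ({\<one>\<^bsub>G\<^esub>} \<times> S\<^sub>H)) f"
proof
  let ?S = "product_generators G S\<^sub>G H S\<^sub>H"
  let ?V = "carrier (G \<times>\<times> H)" and ?E = "cayley_edges (G \<times>\<times> H) ?S"
  assume retains: "retainment_property (G \<times>\<times> H) ?S f"
  have fin: "finite S\<^sub>G" "finite S\<^sub>H"
    using assms(3,4) by (auto simp: finite_symmetric_generating_set_def)
  note growths = assms(5) fin(1) assms(1,6) fin(2) assms(2)
  have "\<forall>\<^sub>F n in sequentially.
      norm (real (\<Sum>k=1..10*n. f k)) \<le> 1/2 * norm (real (growth H S\<^sub>H n))"
    using assms(7) by (rule landau_o.smallD) simp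
  then have "\<forall>\<^sub>F n in sequentially. (\<Sum>k=1..10*n. f k) < growth H S\<^sub>H n"
  proof eventually_elim
    case (elim n)
    have "real (\<Sum>k=1..10*n. f k) \<le> 1/2 * real (growth H S\<^sub>H n)"
      using elim by (simp only: norm_of_nat)
    also have "\<dots> < real (growth H S\<^sub>H n)"
      using growth_pos[OF assms(2) fin(2), of n] by simp
    finally show ?case by (simp only: of_nat_less_iff)
  qed
  then have "\<forall>\<^sub>F n in sequentially. (\<Sum>k=1..10*n. f k) < growth H S\<^sub>H n \<and>
      growth H S\<^sub>H (2 * n) \<le> growth G S\<^sub>G n \<and> n \<ge> 1"
    using growth_double_le_growth[OF growths] eventually_ge_at_top[of 1]
    by eventually_elim auto
  then obtain R where R: "\<And>n. n \<ge> R \<Longrightarrow> (\<Sum>k=1..10*n. f k) < growth H S\<^sub>H n"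
      "\<And>n. n \<ge> R \<Longrightarrow> growth H S\<^sub>H (2 * n) \<le> growth G S\<^sub>G n" "R \<ge> 1"
    unfolding eventually_sequentially by blast
  define F0 where "F0 = {\<one>\<^bsub>G\<^esub>} \<times> cayley_ball H S\<^sub>H R"
  have "finite F0" "F0 \<subseteq> ?V"
    using finite_cayley_ball[OF fin(2)] assms(1)
    by (auto simp: F0_def cayley_ball_def group.is_monoid)
  then obtain W where allowed: "allowed_strategy ?V ?E f F0 W"
    and equiv: "growth_equiv
      (\<lambda>n. real (card (unburned ?V ?E F0 W \<inter> cayley_ball (G \<times>\<times> H) ?S n)))
      (\<lambda>n. real (growth (G \<times>\<times> H) ?S n))"
    using retains unfolding retainment_property_def by blast
  interpret fire_on_product G H S\<^sub>G S\<^sub>H f F0 W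
    by (intro fire_on_product.intro assms(1-4) allowed)
  define u where "u = (\<lambda>n. card (unburned ?V ?E F0 W \<inter> cayley_ball (G \<times>\<times> H) ?S n))"
  have u_mono: "u m \<le> u n" if "m \<le> n" for m n
    unfolding u_def using fin
    by (intro card_mono finite_Int disjI2 finite_cayley_ball Int_mono cayley_ball_mono that) simp_all
  obtain C :: real where C: "C > 0"
    and le: "\<And>m. real (growth (G \<times>\<times> H) ?S m) \<le> C * real (u (nat \<lfloor>C * real m\<rfloor>)) + C"
    using equiv unfolding growth_equiv_def growth_le_def u_def by blast
  obtain N where N: "\<And>n. n \<ge> N \<Longrightarrow>
      C * (real (growth H S\<^sub>H n))\<^sup>2 + C < real (growth G S\<^sub>G (nat \<lfloor>real n / C\<rfloor>))"
    using exponential_beats_square_of_subexponential[OF growths C]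
    unfolding eventually_sequentially by blast
  define n where "n = 2 ^ N * R"
  have "N \<le> 2 ^ N" by (simp add: less_imp_le)
  also have "\<dots> \<le> n" using R(3) by (simp add: n_def)
  finally have "N \<le> n" .
  have "R \<le> n" by (simp add: n_def)
  obtain g where g: "g \<in> cayley_ball G S\<^sub>G n" "{g} \<times> cayley_ball H S\<^sub>H n \<subseteq> burning (6 * n)"
    using burning_fibre_at_dyadic_scales[OF _ R(1,2), of R N] unfolding n_def F0_def by blast
  have u_le: "u n \<le> (growth H S\<^sub>H n)\<^sup>2"
    unfolding u_def by (rule card_unburned_le[OF R(1)[OF \<open>R \<le> n\<close>] g])
  \<comment> \<open>At \<open>m\<close>, the relation \<open>growth_le\<close> looks at survivors in a ball of radius at most \<open>n\<close>.\<close>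
  define m where "m = nat \<lfloor>real n / C\<rfloor>"
  have "real m \<le> real n / C" using C by (simp add: m_def)
  then have "C * real m \<le> real n" using C by (simp add: field_simps)
  then have "nat \<lfloor>C * real m\<rfloor> \<le> n" by linarith
  then have "u (nat \<lfloor>C * real m\<rfloor>) \<le> (growth H S\<^sub>H n)\<^sup>2"
    using u_mono u_le le_trans by blast
  then have "real (u (nat \<lfloor>C * real m\<rfloor>)) \<le> (real (growth H S\<^sub>H n))\<^sup>2"
    by (metis of_nat_le_iff of_nat_power)
  then have "C * real (u (nat \<lfloor>C * real m\<rfloor>)) + C \<le> C * (real (growth H S\<^sub>H n))\<^sup>2 + C"
    using C by simp
  also have "\<dots> < real (growth G S\<^sub>G m)"
    unfolding m_def by (rule N[OF \<open>N \<le> n\<close>])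
  also have "\<dots> \<le> real (growth (G \<times>\<times> H) ?S m)"
    using growth_le_growth_product[OF assms(1,2) fin] by simp
  finally show False using le[of m] by simp
qed

end
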